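(* Let $G$ be a $2$-connected nontrivial uniquely $C_9$-saturated graph, let $C$ be a longest even cycle among the even cycles of $G$ of length at most $12$, and suppose that $C$ has length $12$. Let $R=V(G)\setminus V(C)$. Then every $x\in R$ has exactly two neighbours in $G$, both on $C$, and these two neighbours are at $C$-distance $1$ or $3$.
   Context: All graphs are finite and simple. A graph $G$ is uniquely $C_9$-saturated if it contains no cycle of length $9$ and, for every edge $e$ of the complement $\overline{G}$, $G+e$ contains exactly one cycle of length $9$; it is nontrivial if $|V(G)|\ge 9$. Writing $C=[c_0,c_1,\dots,c_{11}]$ in cyclic order, the $C$-distance of $c_i,c_j$ ($0\le i,j\le 11$) is $\min(|i-j|,12-|i-j|)$. *)

theory Defs
  imports Main
begin

definition simple_graph :: "'a set \<Rightarrow> 'a set set \<Rightarrow> bool" where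
  "simple_graph V E \<longleftrightarrow> finite V \<and> E \<subseteq> {{u, v} | u v. u \<in> V \<and> v \<in> V \<and> u \<noteq> v}"

definition complement_edges :: "'a set \<Rightarrow> 'a set set \<Rightarrow> 'a set set" where
  "complement_edges V E = {{u, v} | u v. u \<in> V \<and> v \<in> V \<and> u \<noteq> v} - E"

definition nbrs :: "'a set set \<Rightarrow> 'a \<Rightarrow> 'a set" where
  "nbrs E x = {y. {x, y} \<in> E}"

definition induced_edges :: "'a set set \<Rightarrow> 'a set \<Rightarrow> 'a set set" where
  "induced_edges E W = {e \<in> E. e \<subseteq> W}"

definition connected_graph :: "'a set \<Rightarrow> 'a set set \<Rightarrow> bool" where
  "connected_graph V E \<longleftrightarrow> V \<noteq> {} \<and> (\<forall>u\<in>V. \<forall>v\<in>V. (u, v) \<in> {(x, y). {x, y} \<in> E}\<^sup>*)"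

definition k_connected :: "nat \<Rightarrow> 'a set \<Rightarrow> 'a set set \<Rightarrow> bool" where
  "k_connected k V E \<longleftrightarrow> card V > k \<and>
     (\<forall>X. X \<subseteq> V \<and> card X < k \<longrightarrow> connected_graph (V - X) (induced_edges E (V - X)))"

definition cycle_edges :: "'a list \<Rightarrow> 'a set set" where
  "cycle_edges c = {{c ! i, c ! (Suc i mod length c)} | i. i < length c}"

text \<open>A cycle presented by its vertices in cyclic order, with a starting point and a direction.\<close>

definition is_cycle :: "'a set set \<Rightarrow> 'a list \<Rightarrow> bool" where
  "is_cycle E c \<longleftrightarrow> length c \<ge> 3 \<and> distinct c \<and> cycle_edges c \<subseteq> E"

text \<open>Cycles are counted as subgraphs. A cycle subgraph is determined by its edge set, so the
  different lists that traverse the same cycle give one element here.\<close>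

definition cycles :: "nat \<Rightarrow> 'a set set \<Rightarrow> 'a set set set" where
  "cycles k E = {cycle_edges c | c. is_cycle E c \<and> length c = k}"

definition uniquely_cycle_saturated :: "nat \<Rightarrow> 'a set \<Rightarrow> 'a set set \<Rightarrow> bool" where
  "uniquely_cycle_saturated k V E \<longleftrightarrow>
     cycles k E = {} \<and> (\<forall>e \<in> complement_edges V E. \<exists>!F. F \<in> cycles k (insert e E))"

definition longest_even_cycle_upto :: "nat \<Rightarrow> 'a set set \<Rightarrow> 'a list \<Rightarrow> bool" where
  "longest_even_cycle_upto m E c \<longleftrightarrow>
     is_cycle E c \<and> even (length c) \<and> length c \<le> m \<and>
     (\<forall>d. is_cycle E d \<and> even (length d) \<and> length d \<le> m \<longrightarrow> length d \<le> length c)"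

text \<open>Distance of the positions \<open>i, j < n\<close> around a cycle of length \<open>n\<close>.\<close>

definition cyclic_dist :: "nat \<Rightarrow> nat \<Rightarrow> nat \<Rightarrow> int" where
  "cyclic_dist n i j = min \<bar>int i - int j\<bar> (int n - \<bar>int i - int j\<bar>)"

end

theory Submission
  imports Defs "HOL-Number_Theory.Cong"
begin

text \<open>
  Closing a path with eight edges by an edge between its ends gives a cycle of length nine.
  Hence unique saturation says that the ends of such a path are not adjacent, and that two such
  paths with the same ends close up to the same cycle; in particular they have the same vertices.
  Everything follows from exhibiting suitable pairs of paths with eight edges
  around a cycle \<open>c\<^sub>0, \<dots>, c\<^sub>1\<^sub>1\<close>.

  Two ends at distance four on the cycle are already joined by the long arc between them.
  If a vertex \<open>x\<close> off the cycle had two neighbours at distance two or four, a detour through \<open>x\<close>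
  would give a second such path (lemmas \<open>no_ear_2\<close>, \<open>no_ear_4\<close>). Distance five gives a cycle of
  length nine, and distance six a theta graph in which a pair of vertices is joined twice.
  So the neighbours of \<open>x\<close> on the cycle are pairwise at distance one or three. Both
  distances are odd and the cycle is even, so parity allows at most two neighbours.

  If \<open>a\<close>, \<open>b\<close> are adjacent vertices off the cycle and \<open>b\<close> is adjacent to \<open>c\<^sub>i\<close>, then
  walking \<open>a, b, c\<^sub>i\<close> and half-way round the cycle in either direction joins \<open>a\<close> to the antipode
  \<open>c\<^bsub>i+6\<^esub>\<close> twice (lemma \<open>no_pendant_path\<close>). So a vertex off the cycle that has a neighbour on it
  has no neighbour off it; connectedness extends this to all vertices off the cycle, and
  2-connectedness gives each of them at least two neighbours.
\<close>

section \<open>Paths with eight edges in a uniquely saturated graph\<close>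

definition is_path :: "'a set set \<Rightarrow> 'a list \<Rightarrow> bool" where
  "is_path E p \<longleftrightarrow> distinct p \<and> successively (\<lambda>u v. {u, v} \<in> E) p"

lemma is_path_closes_to_cycle:
  assumes "is_path E p" "length p \<ge> 3" "{last p, hd p} \<in> E"
  shows "is_cycle E p"
proof -
  have "{p ! i, p ! (Suc i mod length p)} \<in> E" if i: "i < length p" for i
  proof (cases "Suc i < length p")
    case True
    then show ?thesis
      using assms(1) by (simp add: is_path_def successively_conv_nth)
  next
    case False
    with i have "Suc i = length p" by simp
    moreover from this have "i = length p - 1" by simp
    moreover have "p \<noteq> []" using assms(2) by auto
    ultimately show ?thesis
      using assms(3) by (simp add: last_conv_nth hd_conv_nth)
  qed
  then show ?thesis
    using assms(1,2) by (auto simp: is_cycle_def is_path_def cycle_edges_def)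
qed

lemma Union_cycle_edges: "\<Union> (cycle_edges p) = set p"
proof
  show "\<Union> (cycle_edges p) \<subseteq> set p"
  proof
    fix v assume "v \<in> \<Union> (cycle_edges p)"
    then obtain i where i: "i < length p" and v: "v = p ! i \<or> v = p ! (Suc i mod length p)"
      by (auto simp: cycle_edges_def)
    from i have "Suc i mod length p < length p" by (intro mod_less_divisor) linarith
    with i v show "v \<in> set p" by auto
  qed
  show "set p \<subseteq> \<Union> (cycle_edges p)"
  proof
    fix v assume "v \<in> set p"
    then obtain i where i: "i < length p" and v: "v = p ! i" by (auto simp: in_set_conv_nth)
    have "{p ! i, p ! (Suc i mod length p)} \<in> cycle_edges p"
      using i by (auto simp: cycle_edges_def)
    then show "v \<in> \<Union> (cycle_edges p)" using v by blast
  qed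
qed

lemma is_path_mono: "is_path E p \<Longrightarrow> E \<subseteq> F \<Longrightarrow> is_path F p"
  unfolding is_path_def by (auto simp: successively_conv_nth)

lemma saturated_path_ends_not_adjacent:
  assumes sat: "uniquely_cycle_saturated 9 V E"
    and p: "is_path E p" "length p = 9"
  shows "{last p, hd p} \<notin> E"
proof
  assume "{last p, hd p} \<in> E"
  then have "is_cycle E p" using p by (intro is_path_closes_to_cycle) auto
  then have "cycle_edges p \<in> cycles 9 E" using p by (auto simp: cycles_def)
  then show False using sat by (simp add: uniquely_cycle_saturated_def)
qed

lemma simple_graph_edgeD:
  assumes "simple_graph V E" "{u, v} \<in> E"
  shows "u \<in> V" "v \<in> V" "u \<noteq> v"
  using assms unfolding simple_graph_def by (auto simp: doubleton_eq_iff)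

lemma is_path_subset_vertices:
  assumes "simple_graph V E" "is_path E p" "length p \<ge> 2"
  shows "set p \<subseteq> V"
proof
  fix v assume "v \<in> set p"
  then obtain i where i: "i < length p" "v = p ! i" by (auto simp: in_set_conv_nth)
  have edge: "{p ! k, p ! Suc k} \<in> E" if "Suc k < length p" for k
    using assms(2) that by (simp add: is_path_def successively_conv_nth)
  show "v \<in> V"
  proof (cases i)
    case 0
    then show ?thesis using edge[of 0] i assms by (auto dest: simple_graph_edgeD)
  next
    case (Suc k)
    then show ?thesis using edge[of k] i assms by (auto dest: simple_graph_edgeD)
  qed
qed

text \<open>The conclusion compares vertex sets instead of the paths themselves: this is what the
  equality of the two closed cycles gives at once, and the pairs of paths constructed below
  always differ in a vertex.\<close>

lemma saturated_path_vertices_unique: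
  assumes G: "simple_graph V E" and sat: "uniquely_cycle_saturated 9 V E"
    and p: "is_path E p" "length p = 9"
    and q: "is_path E q" "length q = 9"
    and ends: "hd p = hd q" "last p = last q"
  shows "set p = set q"
proof -
  let ?e = "{last p, hd p}"
  have ne: "p \<noteq> []" using p by auto
  have "last p \<noteq> hd p"
    using p ne by (auto simp: is_path_def last_conv_nth hd_conv_nth nth_eq_iff_index_eq)
  moreover have "hd p \<in> V" "last p \<in> V"
    using is_path_subset_vertices[OF G p(1)] p(2) ne by auto
  ultimately have "?e \<in> complement_edges V E"
    using saturated_path_ends_not_adjacent[OF sat p] by (auto simp: complement_edges_def)
  then have unique: "\<exists>!F. F \<in> cycles 9 (insert ?e E)"
    using sat by (simp add: uniquely_cycle_saturated_def)
  have "is_cycle (insert ?e E) p" "is_cycle (insert ?e E) q"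
    using p q ends
    by (auto intro!: is_path_closes_to_cycle elim!: is_path_mono)
  then have "cycle_edges p \<in> cycles 9 (insert ?e E)" "cycle_edges q \<in> cycles 9 (insert ?e E)"
    using p q by (auto simp: cycles_def)
  with unique have "cycle_edges p = cycle_edges q" by blast
  then show ?thesis by (metis Union_cycle_edges)
qed

section \<open>Attaching vertices to a cycle of length twelve\<close>

text \<open>The vertices of the cycle are indexed by all natural numbers modulo twelve, so that an
  arc is a segment of indices wherever it starts, and no case distinction at the starting point
  of the cycle is needed.\<close>

locale saturated_with_12_cycle =
  fixes V :: "'a set" and E :: "'a set set" and c :: "nat \<Rightarrow> 'a"
  assumes graph: "simple_graph V E"
    and sat: "uniquely_cycle_saturated 9 V E"
    and cycle_edge: "{c k, c (Suc k)} \<in> E"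
    and cycle_eq_iff: "c k = c l \<longleftrightarrow> k mod 12 = l mod 12"
begin

lemma cycle_periodic: "c (k + 12) = c k"
  by (simp add: cycle_eq_iff)

text \<open>Rotating the cycle preserves all hypotheses. Hence the paths below are only needed
  for attachments at a fixed vertex, where all indices are numerals.\<close>

lemma rotate_cycle: "saturated_with_12_cycle V E (\<lambda>m. c (i + m))"
proof
  fix k l
  show "{c (i + k), c (i + Suc k)} \<in> E" using cycle_edge[of "i + k"] by simp
  show "c (i + k) = c (i + l) \<longleftrightarrow> k mod 12 = l mod 12"
    unfolding cycle_eq_iff using cong_add_lcancel_nat[of i k l 12] by (simp add: cong_def)
qed (fact graph sat)+

lemma cycle_adjacent:
  assumes "n mod 12 = Suc m mod 12 \<or> m mod 12 = Suc n mod 12"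
  shows "{c m, c n} \<in> E"
  using assms
proof
  assume "n mod 12 = Suc m mod 12"
  then have "c n = c (Suc m)" by (simp add: cycle_eq_iff)
  then show ?thesis using cycle_edge[of m] by simp
next
  assume "m mod 12 = Suc n mod 12"
  then have "c m = c (Suc n)" by (simp add: cycle_eq_iff)
  then show ?thesis using cycle_edge[of n] by (simp add: insert_commute)
qed

lemma off_cycle: "x \<notin> range c \<Longrightarrow> x \<noteq> c k \<and> c k \<noteq> x"
  by auto

lemmas path_simps = is_path_def cycle_adjacent cycle_eq_iff

lemma vertex_on_parallel_path:
  assumes "is_path E p" "is_path E q" "length p = 9" "length q = 9" "hd p = hd q" "last p = last q"
    and "v \<in> set p"
  shows "v \<in> set q"
  using saturated_path_vertices_unique[OF graph sat] assms by blast

lemma no_ear_2: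
  assumes x: "x \<notin> range c" "{x, c 0} \<in> E" "{x, c 2} \<in> E"
  shows False
proof -
  let ?p = "[c 0, c 1, c 2, c 3, c 4, c 5, c 6, c 7, c 8]"
  let ?q = "[c 0, x, c 2, c 3, c 4, c 5, c 6, c 7, c 8]"
  have "is_path E ?p" by (simp add: path_simps)
  moreover have "is_path E ?q"
    using x(2,3) by (simp add: path_simps off_cycle[OF x(1)] insert_commute)
  ultimately have "x \<in> set ?p"
    by (intro vertex_on_parallel_path[of ?q ?p x]) simp_all
  then show False by (simp add: off_cycle[OF x(1)])
qed

text \<open>Going through \<open>x\<close> saves two edges between \<open>c\<^sub>0\<close> and \<open>c\<^sub>4\<close>. Starting at \<open>c\<^sub>1\<close> restores the
  length: the long arc from there loses its first edge, and the detour gains one.\<close>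

lemma no_ear_4:
  assumes x: "x \<notin> range c" "{x, c 0} \<in> E" "{x, c 4} \<in> E"
  shows False
proof -
  let ?p = "[c 1, c 2, c 3, c 4, c 5, c 6, c 7, c 8, c 9]"
  let ?q = "[c 1, c 0, x, c 4, c 5, c 6, c 7, c 8, c 9]"
  have "is_path E ?p" by (simp add: path_simps)
  moreover have "is_path E ?q"
    using x(2,3) by (simp add: path_simps off_cycle[OF x(1)] insert_commute)
  ultimately have "x \<in> set ?p"
    by (intro vertex_on_parallel_path[of ?q ?p x]) simp_all
  then show False by (simp add: off_cycle[OF x(1)])
qed

lemma no_ear_5:
  assumes x: "x \<notin> range c" "{x, c 0} \<in> E" "{x, c 5} \<in> E"
  shows False
proof -
  let ?p = "[x, c 5, c 6, c 7, c 8, c 9, c 10, c 11, c 0]"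
  have "is_path E ?p"
    using x(2,3) by (simp add: path_simps off_cycle[OF x(1)])
  then have "{last ?p, hd ?p} \<notin> E"
    by (rule saturated_path_ends_not_adjacent[OF sat]) simp
  then show False using x(2) by (simp add: insert_commute)
qed

text \<open>Here both ways from \<open>c\<^sub>1\<close> to \<open>c\<^sub>1\<^sub>1\<close> use \<open>x\<close>: once around \<open>c\<^sub>3\<close> on one half
  of the cycle, and once around \<open>c\<^sub>9\<close> on the other.\<close>

lemma no_ear_6:
  assumes x: "x \<notin> range c" "{x, c 0} \<in> E" "{x, c 6} \<in> E"
  shows False
proof -
  let ?p = "[c 1, c 2, c 3, c 4, c 5, c 6, x, c 0, c 11]"
  let ?q = "[c 1, c 0, x, c 6, c 7, c 8, c 9, c 10, c 11]"
  have "is_path E ?p" "is_path E ?q"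
    using x(2,3) by (simp_all add: path_simps off_cycle[OF x(1)] insert_commute)
  then have "c 3 \<in> set ?q" by (rule vertex_on_parallel_path) simp_all
  then show False by (simp add: cycle_eq_iff off_cycle[OF x(1)])
qed

lemma no_pendant_path_at_start:
  assumes a: "a \<notin> range c" and b: "b \<notin> range c"
    and ab: "{a, b} \<in> E" and bc: "{b, c 0} \<in> E"
  shows False
proof -
  let ?p = "[a, b, c 0, c 1, c 2, c 3, c 4, c 5, c 6]"
  let ?q = "[a, b, c 0, c 11, c 10, c 9, c 8, c 7, c 6]"
  have "a \<noteq> b" using simple_graph_edgeD(3)[OF graph ab] .
  then have "is_path E ?p" "is_path E ?q"
    using ab bc by (simp_all add: path_simps off_cycle[OF a] off_cycle[OF b])
  then have "c 3 \<in> set ?q" by (rule vertex_on_parallel_path) simp_all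
  then show False by (simp add: cycle_eq_iff off_cycle[OF a] off_cycle[OF b])
qed

lemma no_pendant_path:
  assumes "a \<notin> range c" "b \<notin> range c" "{a, b} \<in> E" "{b, c i} \<in> E"
  shows False
proof -
  interpret rot: saturated_with_12_cycle V E "\<lambda>m. c (i + m)" by (rule rotate_cycle)
  have "a \<notin> range (\<lambda>m. c (i + m))" "b \<notin> range (\<lambda>m. c (i + m))"
    using assms(1,2) by blast+
  then show False
    by (rule rot.no_pendant_path_at_start[OF _ _ assms(3)]) (use assms(4) in simp)
qed

lemma forward_distance_of_neighbours:
  assumes x: "x \<notin> range c" "{x, c i} \<in> E" "{x, c (i + d)} \<in> E" and d: "0 < d" "d < 12"
  shows "d \<in> {1, 3, 9, 11}"
proof -
  have excluded: "d \<notin> {2, 4, 5, 6}"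
    if "{x, c i} \<in> E" "{x, c (i + d)} \<in> E" for i d
  proof -
    interpret rot: saturated_with_12_cycle V E "\<lambda>m. c (i + m)" by (rule rotate_cycle)
    have off: "x \<notin> range (\<lambda>m. c (i + m))" using x(1) by blast
    have "{x, c (i + 0)} \<in> E" using that(1) by simp
    note ears = rot.no_ear_2[OF off this] rot.no_ear_4[OF off this]
      rot.no_ear_5[OF off this] rot.no_ear_6[OF off this]
    show ?thesis
    proof
      assume "d \<in> {2, 4, 5, 6}"
      then consider "d = 2" | "d = 4" | "d = 5" | "d = 6" by blast
      then show False using ears that(2) by cases blast+
    qed
  qed
  have "d \<notin> {2, 4, 5, 6}" using excluded x by blast
  \<comment> \<open>The distance \<open>d\<close> in one direction is \<open>12 - d\<close> in the other.\<close>
  moreover have "12 - d \<notin> {2, 4, 5, 6}"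
  proof (rule excluded[of "i + d"])
    have "c (i + d + (12 - d)) = c i" using d cycle_periodic[of i] by simp
    then show "{x, c (i + d + (12 - d))} \<in> E" using x(2) by simp
  qed (fact x(3))
  moreover have "d = 1 \<or> d = 2 \<or> d = 3 \<or> d = 4 \<or> d = 5 \<or> d = 6 \<or> d = 7 \<or> d = 8 \<or> d = 9 \<or> d = 10 \<or> d = 11"
    using d by presburger
  ultimately show ?thesis by (elim disjE) simp_all
qed

lemma distance_of_neighbours:
  assumes x: "x \<notin> range c" "{x, c i} \<in> E" "{x, c j} \<in> E"
    and ij: "i < 12" "j < 12" "i \<noteq> j"
  shows "cyclic_dist 12 i j \<in> {1, 3}" "even i \<noteq> even j"
proof -
  have *: "cyclic_dist 12 i j \<in> {1, 3} \<and> cyclic_dist 12 j i \<in> {1, 3} \<and> even i \<noteq> even j"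
    if "{x, c i} \<in> E" "{x, c j} \<in> E" "i < j" "j < 12" for i j
  proof -
    have "j - i \<in> {1, 3, 9, 11}"
      by (rule forward_distance_of_neighbours[OF x(1) that(1)]) (use that in simp_all)
    then consider "j = i + 1" | "j = i + 3" | "j = i + 9" | "j = i + 11"
      using that(3) by fastforce
    then show ?thesis by cases (simp_all add: cyclic_dist_def)
  qed
  consider "i < j" | "j < i" using ij(3) by linarith
  then have "cyclic_dist 12 i j \<in> {1, 3} \<and> even i \<noteq> even j"
    using *[of i j] *[of j i] x(2,3) ij by cases simp_all
  then show "cyclic_dist 12 i j \<in> {1, 3}" "even i \<noteq> even j" by blast+
qed

text \<open>Two of three indices have the same parity.\<close>

lemma no_three_neighbours:
  assumes "x \<notin> range c"
    and "{x, c i} \<in> E" "{x, c j} \<in> E" "{x, c k} \<in> E" "i < 12" "j < 12" "k < 12"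
  shows "i = j \<or> j = k \<or> i = k"
  using distance_of_neighbours(2)[OF assms(1)] assms(2-) by metis

lemma rangeE_below_12:
  assumes "v \<in> range c"
  obtains i where "i < 12" "v = c i"
proof -
  from assms obtain k where "v = c k" by blast
  then have "v = c (k mod 12)" by (simp add: cycle_eq_iff)
  then show thesis using that[of "k mod 12"] by simp
qed

section \<open>Using connectedness\<close>

text \<open>Being on the cycle or adjacent to it passes from a vertex to its neighbours, because a
  neighbour off the cycle of a vertex off the cycle would start a path excluded above.\<close>

lemma adjacent_to_cycle:
  assumes conn: "k_connected 2 V E" and x: "x \<in> V" "x \<notin> range c"
  shows "\<exists>i. {x, c i} \<in> E"
proof -
  have "connected_graph V (induced_edges E V)"
    using conn unfolding k_connected_def by (metis Diff_empty card.empty empty_subsetI zero_less_numeral)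
  moreover have "c 0 \<in> V" using simple_graph_edgeD(1)[OF graph cycle_edge] .
  ultimately have "(x, c 0) \<in> {(u, v). {u, v} \<in> induced_edges E V}\<^sup>*"
    using x(1) by (simp add: connected_graph_def)
  then have "x \<in> range c \<or> (\<exists>i. {x, c i} \<in> E)"
  proof (induction rule: converse_rtrancl_induct)
    case base
    then show ?case by simp
  next
    case (step y z)
    then have yz: "{y, z} \<in> E" by (simp add: induced_edges_def)
    show ?case
    proof (cases "z \<in> range c")
      case True
      then show ?thesis using yz by auto
    next
      case False
      with step.IH obtain i where "{z, c i} \<in> E" by blast
      then show ?thesis using no_pendant_path[OF _ False yz] by blast
    qed
  qed
  with x(2) show ?thesis by blast
qed

lemma nbrs_subset_cycle:
  assumes "k_connected 2 V E" "x \<in> V" "x \<notin> range c"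
  shows "nbrs E x \<subseteq> range c"
proof
  fix y assume "y \<in> nbrs E x"
  then have xy: "{y, x} \<in> E" by (simp add: nbrs_def insert_commute)
  obtain i where "{x, c i} \<in> E" using adjacent_to_cycle[OF assms] by blast
  then show "y \<in> range c" using no_pendant_path[OF _ assms(3) xy] by blast
qed

text \<open>Deleting one neighbour of \<open>x\<close> must leave \<open>x\<close> connected to the rest of the cycle, which
  gives a second neighbour; three neighbours on the cycle are impossible by parity.\<close>

lemma card_nbrs_off_cycle:
  assumes conn: "k_connected 2 V E" and x: "x \<in> V" "x \<notin> range c"
  shows "card (nbrs E x) = 2"
proof -
  obtain i where xi: "{x, c i} \<in> E" using adjacent_to_cycle[OF assms] by blast
  let ?W = "V - {c i}"
  have c_in: "c k \<in> V" for k using simple_graph_edgeD(1)[OF graph cycle_edge] .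
  have "connected_graph ?W (induced_edges E ?W)"
    using conn c_in[of i] unfolding k_connected_def by auto
  moreover have "c (Suc i) \<noteq> c i"
    using simple_graph_edgeD(3)[OF graph cycle_edge] by metis
  ultimately have "(x, c (Suc i)) \<in> {(u, v). {u, v} \<in> induced_edges E ?W}\<^sup>*"
    using x c_in by (auto simp: connected_graph_def)
  then obtain y where "{x, y} \<in> induced_edges E ?W"
    using x(2) by (auto elim: converse_rtranclE)
  then have y: "{x, y} \<in> E" "y \<noteq> c i" by (auto simp: induced_edges_def)
  have onC: "v \<in> range c" if "{x, v} \<in> E" for v
    using nbrs_subset_cycle[OF assms] that by (auto simp: nbrs_def)
  have "nbrs E x = {c i, y}"
  proof
    show "{c i, y} \<subseteq> nbrs E x" using xi y by (simp add: nbrs_def)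
    show "nbrs E x \<subseteq> {c i, y}"
    proof
      fix z assume "z \<in> nbrs E x"
      then have z: "{x, z} \<in> E" by (simp add: nbrs_def)
      obtain i' where "i' < 12" "c i = c i'" by (rule rangeE_below_12[of "c i"]) auto
      moreover obtain j where "j < 12" "y = c j"
        by (rule rangeE_below_12[OF onC[OF y(1)]])
      moreover obtain k where "k < 12" "z = c k"
        by (rule rangeE_below_12[OF onC[OF z]])
      ultimately show "z \<in> {c i, y}"
        using no_three_neighbours[OF x(2), of i' j k] xi y z by auto
    qed
  qed
  then show ?thesis using y(2) by simp
qed

end

theorem lemma3p2:
  fixes V :: "'a set" and E :: "'a set set" and C :: "'a list"
  assumes "simple_graph V E"
    and "k_connected 2 V E"
    and "card V \<ge> 9"
    and "uniquely_cycle_saturated 9 V E"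
    and "longest_even_cycle_upto 12 E C"
    and "length C = 12"
  shows "\<forall>x \<in> V - set C. card (nbrs E x) = 2 \<and> nbrs E x \<subseteq> set C \<and>
           (\<forall>i<12. \<forall>j<12. nbrs E x = {C ! i, C ! j} \<longrightarrow> cyclic_dist 12 i j \<in> {1, 3})"
proof -
  define c where "c k = C ! (k mod 12)" for k
  have C: "distinct C" "cycle_edges C \<subseteq> E"
    using assms(5) by (auto simp: longest_even_cycle_upto_def is_cycle_def)
  interpret saturated_with_12_cycle V E c
  proof
    fix k l
    have "{C ! (k mod 12), C ! (Suc (k mod 12) mod 12)} \<in> cycle_edges C"
      unfolding cycle_edges_def assms(6) by (auto intro!: exI[of _ "k mod 12"])
    with C(2) show "{c k, c (Suc k)} \<in> E" by (auto simp: c_def mod_Suc_eq)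
    show "c k = c l \<longleftrightarrow> k mod 12 = l mod 12"
      using C(1) assms(6) by (simp add: c_def nth_eq_iff_index_eq)
  qed (fact assms)+
  have set_C: "set C = range c"
  proof
    show "set C \<subseteq> range c"
    proof
      fix v assume "v \<in> set C"
      then obtain k where "k < 12" "v = C ! k" using assms(6) by (auto simp: in_set_conv_nth)
      then have "v = c k" by (simp add: c_def)
      then show "v \<in> range c" by simp
    qed
    show "range c \<subseteq> set C" using assms(6) by (auto simp: c_def)
  qed
  show ?thesis
  proof (intro ballI conjI allI impI)
    fix x assume "x \<in> V - set C"
    then have x: "x \<in> V" "x \<notin> range c" by (auto simp: set_C)
    show card2: "card (nbrs E x) = 2" by (rule card_nbrs_off_cycle[OF assms(2) x])
    show "nbrs E x \<subseteq> set C" unfolding set_C by (rule nbrs_subset_cycle[OF assms(2) x])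
    fix i j :: nat
    assume ij: "i < 12" "j < 12" and N: "nbrs E x = {C ! i, C ! j}"
    have "i \<noteq> j" using card2 N by auto
    moreover have "{x, c i} \<in> E" "{x, c j} \<in> E"
      using N ij by (auto simp: nbrs_def c_def)
    ultimately show "cyclic_dist 12 i j \<in> {1, 3}"
      using distance_of_neighbours(1)[OF x(2)] ij by blast
  qed
qed

end
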